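(* Let the data at time $t^n$ be well-prepared, i.e. $\rho^n=\rho^n_{(0)}+\varepsilon^2\rho^n_{(2)}$, $q^n=q^n_{(0)}+\varepsilon^2 q^n_{(2)}$ with $\rho^n_{(0)}=1$ and $\nabla\cdot q^n_{(0)}=0$. Consider the $s$-stage SI-IMEX-RK-DAE scheme for the Euler-Poisson system (given in the context), based on a stiffly accurate DIRK scheme. Suppose that for every $k=1,\dots,s$ the intermediate solutions $(\rho^k_E,q^k_E)$ and $(\rho^k_I,q^k_I,\phi^k_I)$ admit the ansatz $$\rho^k_E=\rho^k_{E,(0)}+\varepsilon^2\rho^k_{E,(2)},\quad q^k_E=q^k_{E,(0)}+\varepsilon^2q^k_{E,(2)},\quad \rho^k_I=\rho^k_{I,(0)}+\varepsilon^2\rho^k_{I,(2)},\quad q^k_I=q^k_{I,(0)}+\varepsilon^2q^k_{I,(2)},$$ with $\phi^k_I\to\phi^k_{I,(0)}$ as $\varepsilon\to0$. Then for every $k=1,\dots,s$ $$\lim_{\varepsilon\to0}\rho^k_E=\rho^k_{E,(0)}=1,\qquad \lim_{\varepsilon\to0}\rho^k_I=\rho^k_{I,(0)}=1,$$ $$\lim_{\varepsilon\to0}\nabla\cdot q^k_E=\nabla\cdot q^k_{E,(0)}=0,\qquad \lim_{\varepsilon\to0}\nabla\cdot q^k_I=\nabla\cdot q^k_{I,(0)}=0,$$ i.e. the intermediate solutions are well-prepared. As a result, the numerical solution $(\rho^{n+1},q^{n+1},\phi^{n+1})$ after one time step is consistent with the reformulated incompressible Euler system, in the sense that the SI-IMEX-RK-DAE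 scheme transforms, in the quasineutral limit $\varepsilon\to0$, to an $s$-stage scheme for the incompressible Euler system (in the precise sense given in the context). In other words, the SI-IMEX-RK-DAE scheme is asymptotically consistent.
   Context: The one-fluid Euler-Poisson system for density $\rho\ge0$, momentum $q=\rho u\in\mathbb R^d$ and electric potential $\phi\in\mathbb R$, as functions of $t\ge0$, $x\in\mathbb R^d$, is $$\partial_t\rho+\nabla\cdot q=0,\quad \partial_tq+\nabla\cdot\Big(\frac{q\otimes q}{\rho}\Big)+\nabla p(\rho)=\rho\nabla\phi,\quad \varepsilon^2\Delta\phi=\rho-1,$$ with $p(\rho)=\rho^\gamma$, $\gamma>1$, and a parameter $\varepsilon>0$ (scaled Debye length). Runge-Kutta coefficients: $\tilde A=(\tilde a_{k,\ell})$ and $A=(a_{k,\ell})$ are $s\times s$ real matrices and $\omega$ is a vector of weights, with $\tilde a_{k,\ell}=0$ for $\ell\ge k$ and $a_{k,\ell}=0$ for $\ell>k$ (DIRK). Stiffly accurate (SA) means that the last row of $A$ equals $\omega$. The time step $\Delta t>0$ is fixed, independent of $\varepsilon$. SI-IMEX-RK-DAE scheme: given $(\rho^n,q^n,\phi^n)$, for $k=1,\dots,s$ the stages $(\rho_E^k,q_E^k)$ and $(\rho_I^k,q_I^k,\phi_I^k)$ (functions of $x$) satisfy $$\rho_E^k=\rho^n-\Delta t\sum_{\ell=1}^{k-1}\tilde a_{k,\ell}\nabla\cdot q_I^\ell,$$ $$q_E^k=q^n-\Delta t\sum_{\ell=1}^{k-1}\tilde a_{k,\ell}\Big[\nabla\cdot\Big(\frac{q_E^\ell\otimes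 q_E^\ell}{\rho_E^\ell}\Big)+\nabla p(\rho_E^\ell)-\rho_E^\ell\nabla\phi_I^\ell\Big],$$ $$\rho_I^k=\rho^n-\Delta t\sum_{\ell=1}^{k}a_{k,\ell}\nabla\cdot q_I^\ell,$$ $$q_I^k=q^n-\Delta t\sum_{\ell=1}^{k}a_{k,\ell}\Big[\nabla\cdot\Big(\frac{q_E^\ell\otimes q_E^\ell}{\rho_E^\ell}\Big)+\nabla p(\rho_E^\ell)-\rho_E^\ell\nabla\phi_I^\ell\Big],$$ $$\varepsilon^2\Delta\phi_I^k=\rho_I^k-1,$$ and the update is $(\rho^{n+1},q^{n+1},\phi^{n+1})=(\rho_I^s,q_I^s,\phi_I^s)$. The analysis is formal: all functions are smooth, and limits as $\varepsilon\to0$ exist and commute with spatial differentiation. The subscript $(0)$ denotes the limit as $\varepsilon\to0$, and $u_{(0)}=q_{(0)}/\rho_{(0)}$ for the corresponding stage or time level. The incompressible Euler limit system is $\nabla\cdot u_{(0)}=0$, $\partial_tu_{(0)}+\nabla\cdot(u_{(0)}\otimes u_{(0)})=\nabla\phi_{(0)}$, $\rho_{(0)}=1$. Its reformulated version is $$\Delta\phi_{(0)}=\nabla^2:(u_{(0)}\otimes u_{(0)}),\quad \partial_tu_{(0)}+\nabla\cdot(u_{(0)}\otimes u_{(0)})=\nabla\phi_{(0)},\quad \rho_{(0)}=1,\quad \nabla\cdot u_{(0)}(0)=0.$$ Here $\nabla^2:(v\otimes v)=\sum_{i,j}\partial_{x_i}\partial_{x_j}(v_iv_j)$. "Transforms to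 an $s$-stage scheme for the incompressible Euler system" means that the limits satisfy, for $k=1,\dots,s$, $\rho^k_{E,(0)}=\rho^k_{I,(0)}=1$ and $$u^k_{E,(0)}=u^n_{(0)}-\Delta t\sum_{\ell=1}^{k-1}\tilde a_{k,\ell}\big[\nabla\cdot(u^\ell_{E,(0)}\otimes u^\ell_{E,(0)})-\nabla\phi^\ell_{I,(0)}\big],$$ $$u^k_{I,(0)}=u^n_{(0)}-\Delta t\sum_{\ell=1}^{k}a_{k,\ell}\big[\nabla\cdot(u^\ell_{E,(0)}\otimes u^\ell_{E,(0)})-\nabla\phi^\ell_{I,(0)}\big],$$ $$\Delta\phi^k_{I,(0)}=\nabla^2:(u^k_{E,(0)}\otimes u^k_{E,(0)}),$$ with $(\rho^{n+1}_{(0)},u^{n+1}_{(0)},\phi^{n+1}_{(0)})=(\rho^s_{I,(0)},u^s_{I,(0)},\phi^s_{I,(0)})$; this is a Runge-Kutta time discretisation of the reformulated incompressible Euler system.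
   Formalization: The diagonal coefficients a_{k,k} are additionally assumed nonzero for k=1,…,s (A invertible); otherwise the claim fails, e.g. s=1, A=0, ρ^n=1+ε², q^n=0, φ=x_1²/2 gives Δφ=1 instead of 0. *)

theory Defs
  imports "HOL-Analysis.Analysis"
begin

section \<open>Spatial differential operators\<close>

definition pd :: "'d::finite \<Rightarrow> (real^'d \<Rightarrow> 'b::real_normed_vector) \<Rightarrow> real^'d \<Rightarrow> 'b" where
  "pd i f x = frechet_derivative f (at x) (axis i 1)"

fun pds :: "'d::finite list \<Rightarrow> (real^'d \<Rightarrow> 'b::real_normed_vector) \<Rightarrow> real^'d \<Rightarrow> 'b" where
  "pds [] f = f"
| "pds (i # is) f = pd i (pds is f)"

definition smooth :: "(real^'d::finite \<Rightarrow> 'b::real_normed_vector) \<Rightarrow> bool" where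
  "smooth f \<longleftrightarrow> (\<forall>is x. pds is f differentiable (at x))"

definition gradient :: "(real^'d::finite \<Rightarrow> real) \<Rightarrow> real^'d \<Rightarrow> real^'d" where
  "gradient f x = (\<chi> i. pd i f x)"

definition divergence :: "(real^'d::finite \<Rightarrow> real^'d) \<Rightarrow> real^'d \<Rightarrow> real" where
  "divergence q x = (\<Sum>i\<in>UNIV. pd i (\<lambda>y. q y $ i) x)"

definition laplacian :: "(real^'d::finite \<Rightarrow> real) \<Rightarrow> real^'d \<Rightarrow> real" where
  "laplacian f x = (\<Sum>i\<in>UNIV. pd i (pd i f) x)"

definition tensor_divergence :: "(real^'d::finite \<Rightarrow> real^'d^'d) \<Rightarrow> real^'d \<Rightarrow> real^'d" where
  "tensor_divergence T x = (\<chi> i. \<Sum>j\<in>UNIV. pd j (\<lambda>y. T y $ i $ j) x)"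

definition hess_contract :: "(real^'d::finite \<Rightarrow> real^'d^'d) \<Rightarrow> real^'d \<Rightarrow> real" where
  "hess_contract T x = (\<Sum>i\<in>UNIV. \<Sum>j\<in>UNIV. pd i (pd j (\<lambda>y. T y $ i $ j)) x)"

definition outer :: "real^'d::finite \<Rightarrow> real^'d \<Rightarrow> real^'d^'d" where
  "outer v w = (\<chi> i j. v $ i * w $ j)"

section \<open>Formal asymptotics as the parameter tends to 0 from the right\<close>

text \<open>
  The formal calculus "all functions are smooth, limits exist and commute with spatial
  differentiation" is made precise as pointwise convergence of all iterated spatial
  derivatives, with no uniformity in space.
\<close>

definition formal_lim ::
  "(real \<Rightarrow> real^'d::finite \<Rightarrow> 'b::real_normed_vector) \<Rightarrow> (real^'d \<Rightarrow> 'b) \<Rightarrow> bool" where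
  "formal_lim f f0 \<longleftrightarrow>
     (\<forall>\<^sub>F eps in at_right 0. smooth (f eps)) \<and> smooth f0 \<and>
     (\<forall>is x. ((\<lambda>eps. pds is (f eps) x) \<longlongrightarrow> pds is f0 x) (at_right 0))"

text \<open>
  The ansatz \<open>f = f0 + eps^2 f2\<close>.  The coefficient \<open>f2\<close> may itself depend on \<open>eps\<close>, provided
  that it and its spatial derivatives stay bounded as \<open>eps\<close> tends to 0 (pointwise in space);
  a coefficient independent of \<open>eps\<close>, or one with a formal limit, is a special case.
\<close>

definition ansatz ::
  "(real \<Rightarrow> real^'d::finite \<Rightarrow> 'b::real_normed_vector) \<Rightarrow> (real^'d \<Rightarrow> 'b) \<Rightarrow>
   (real \<Rightarrow> real^'d \<Rightarrow> 'b) \<Rightarrow> bool" where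
  "ansatz f f0 f2 \<longleftrightarrow>
     smooth f0 \<and> (\<forall>\<^sub>F eps in at_right 0. smooth (f2 eps)) \<and>
     (\<forall>is x. Bfun (\<lambda>eps. pds is (f2 eps) x) (at_right 0)) \<and>
     (\<forall>\<^sub>F eps in at_right 0. \<forall>x. f eps x = f0 x + eps\<^sup>2 *\<^sub>R f2 eps x)"

definition well_prepared ::
  "(real \<Rightarrow> real^'d::finite \<Rightarrow> real) \<Rightarrow> (real \<Rightarrow> real^'d \<Rightarrow> real^'d) \<Rightarrow>
   (real^'d \<Rightarrow> real) \<Rightarrow> (real^'d \<Rightarrow> real^'d) \<Rightarrow>
   (real \<Rightarrow> real^'d \<Rightarrow> real) \<Rightarrow> (real \<Rightarrow> real^'d \<Rightarrow> real^'d) \<Rightarrow> bool" where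
  "well_prepared rho q rho0 q0 rho2 q2 \<longleftrightarrow>
     ansatz rho rho0 rho2 \<and> ansatz q q0 q2 \<and>
     (\<forall>x. rho0 x = 1) \<and> (\<forall>x. divergence q0 x = 0)"

definition velocity :: "(real^'d::finite \<Rightarrow> real) \<Rightarrow> (real^'d \<Rightarrow> real^'d) \<Rightarrow> real^'d \<Rightarrow> real^'d" where
  "velocity rho q x = q x /\<^sub>R rho x"

section \<open>Runge-Kutta coefficients\<close>

text \<open>Matrices are functions of two indices; only the indices \<open>1, \<dots>, s\<close> matter.\<close>

definition strictly_lower :: "nat \<Rightarrow> (nat \<Rightarrow> nat \<Rightarrow> real) \<Rightarrow> bool" where
  "strictly_lower s At \<longleftrightarrow> (\<forall>k\<in>{1..s}. \<forall>l\<in>{1..s}. k \<le> l \<longrightarrow> At k l = 0)"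

definition dirk :: "nat \<Rightarrow> (nat \<Rightarrow> nat \<Rightarrow> real) \<Rightarrow> bool" where
  "dirk s A \<longleftrightarrow> (\<forall>k\<in>{1..s}. \<forall>l\<in>{1..s}. k < l \<longrightarrow> A k l = 0)"

definition stiffly_accurate :: "nat \<Rightarrow> (nat \<Rightarrow> nat \<Rightarrow> real) \<Rightarrow> (nat \<Rightarrow> real) \<Rightarrow> bool" where
  "stiffly_accurate s A w \<longleftrightarrow> (\<forall>l\<in>{1..s}. A s l = w l)"

section \<open>The SI-IMEX-RK-DAE scheme for the Euler-Poisson system\<close>

definition momentum_flux ::
  "real \<Rightarrow> (real^'d::finite \<Rightarrow> real) \<Rightarrow> (real^'d \<Rightarrow> real^'d) \<Rightarrow> (real^'d \<Rightarrow> real) \<Rightarrow> real^'d \<Rightarrow> real^'d" where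
  "momentum_flux gam rho q phi x =
     tensor_divergence (\<lambda>y. outer (q y) (q y) /\<^sub>R rho y) x
     + gradient (\<lambda>y. rho y powr gam) x - rho x *\<^sub>R gradient phi x"

text \<open>The stages at a fixed value of \<open>eps\<close>.  The old potential does not enter any equation.\<close>

definition si_imex_rk_dae_stages ::
  "nat \<Rightarrow> (nat \<Rightarrow> nat \<Rightarrow> real) \<Rightarrow> (nat \<Rightarrow> nat \<Rightarrow> real) \<Rightarrow> real \<Rightarrow> real \<Rightarrow> real \<Rightarrow>
   (real^'d::finite \<Rightarrow> real) \<Rightarrow> (real^'d \<Rightarrow> real^'d) \<Rightarrow>
   (nat \<Rightarrow> real^'d \<Rightarrow> real) \<Rightarrow> (nat \<Rightarrow> real^'d \<Rightarrow> real^'d) \<Rightarrow>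
   (nat \<Rightarrow> real^'d \<Rightarrow> real) \<Rightarrow> (nat \<Rightarrow> real^'d \<Rightarrow> real^'d) \<Rightarrow> (nat \<Rightarrow> real^'d \<Rightarrow> real) \<Rightarrow> bool" where
  "si_imex_rk_dae_stages s At A dt gam eps rhon qn rhoE qE rhoI qI phiI \<longleftrightarrow>
     (\<forall>k\<in>{1..s}. \<forall>x.
        rhoE k x = rhon x - dt * (\<Sum>l\<in>{1..<k}. At k l * divergence (qI l) x) \<and>
        qE k x = qn x - dt *\<^sub>R (\<Sum>l\<in>{1..<k}. At k l *\<^sub>R momentum_flux gam (rhoE l) (qE l) (phiI l) x) \<and>
        rhoI k x = rhon x - dt * (\<Sum>l\<in>{1..k}. A k l * divergence (qI l) x) \<and>
        qI k x = qn x - dt *\<^sub>R (\<Sum>l\<in>{1..k}. A k l *\<^sub>R momentum_flux gam (rhoE l) (qE l) (phiI l) x) \<and>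
        eps\<^sup>2 * laplacian (phiI k) x = rhoI k x - 1)"

section \<open>The limiting scheme for the reformulated incompressible Euler system\<close>

definition incompressible_flux ::
  "(real^'d::finite \<Rightarrow> real^'d) \<Rightarrow> (real^'d \<Rightarrow> real) \<Rightarrow> real^'d \<Rightarrow> real^'d" where
  "incompressible_flux u phi x =
     tensor_divergence (\<lambda>y. outer (u y) (u y)) x - gradient phi x"

definition incompressible_rk_scheme ::
  "nat \<Rightarrow> (nat \<Rightarrow> nat \<Rightarrow> real) \<Rightarrow> (nat \<Rightarrow> nat \<Rightarrow> real) \<Rightarrow> real \<Rightarrow> (real^'d::finite \<Rightarrow> real^'d) \<Rightarrow>
   (nat \<Rightarrow> real^'d \<Rightarrow> real) \<Rightarrow> (nat \<Rightarrow> real^'d \<Rightarrow> real^'d) \<Rightarrow>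
   (nat \<Rightarrow> real^'d \<Rightarrow> real) \<Rightarrow> (nat \<Rightarrow> real^'d \<Rightarrow> real^'d) \<Rightarrow> (nat \<Rightarrow> real^'d \<Rightarrow> real) \<Rightarrow>
   (real^'d \<Rightarrow> real) \<Rightarrow> (real^'d \<Rightarrow> real^'d) \<Rightarrow> (real^'d \<Rightarrow> real) \<Rightarrow> bool" where
  "incompressible_rk_scheme s At A dt un rhoE uE rhoI uI phiI rho1 u1 phi1 \<longleftrightarrow>
     (\<forall>k\<in>{1..s}. \<forall>x.
        rhoE k x = 1 \<and> rhoI k x = 1 \<and>
        uE k x = un x - dt *\<^sub>R (\<Sum>l\<in>{1..<k}. At k l *\<^sub>R incompressible_flux (uE l) (phiI l) x) \<and>
        uI k x = un x - dt *\<^sub>R (\<Sum>l\<in>{1..k}. A k l *\<^sub>R incompressible_flux (uE l) (phiI l) x) \<and>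
        laplacian (phiI k) x = hess_contract (\<lambda>y. outer (uE k y) (uE k y)) x) \<and>
     rho1 = rhoI s \<and> u1 = uI s \<and> phi1 = phiI s"

end

theory Submission
  imports Defs
begin

text \<open>
  The argument has two layers.  Every quantity that is needed in the limit is a value of a stage
  or of finitely many of its spatial derivatives at one fixed point, so the equations of the scheme
  pass to the limit pointwise.  For the momentum flux this works because the density tends to \<open>1\<close>:
  near a fixed point it is eventually positive, and its gradient tends to \<open>0\<close>, so that the pressure
  disappears and the flux becomes that of the velocity, which is the momentum itself
  (\<open>tendsto_momentum_flux\<close>).

  In the limit the Poisson equation turns into the constraint \<open>rho = 1\<close> on the implicit stages.
  The limit continuity equations of the implicit stages are then a homogeneous triangular system
  for the divergences of the implicit momenta.  Its diagonal is nonzero, so these divergences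
  vanish (\<open>triangular_system_zero\<close>), and then the explicit densities equal \<open>1\<close> too.

  The constraint on the potential is hidden one differentiation deeper.  The divergence of the
  limit momentum equation of the implicit stages is again a homogeneous triangular system, this
  time for the divergences of the fluxes, that is, for
  \<open>hess_contract (outer u u) - laplacian phi\<close> at the explicit velocities.  Hence the elliptic
  equation for the potential holds at every stage.  With all flux divergences gone, the explicit
  momentum equations show that the explicit momenta are divergence-free as well.
\<close>

section \<open>Partial derivatives and smooth functions\<close>

lemma pd_eqI: "(f has_derivative D) (at x) \<Longrightarrow> pd i f x = D (axis i 1)"
  unfolding pd_def by (drule frechet_derivative_at, drule fun_cong, erule sym)

lemma pd_add:
  assumes "f differentiable (at x)" "g differentiable (at x)"
  shows "pd i (\<lambda>y. f y + g y) x = pd i f x + pd i g x"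
proof -
  obtain D E where D: "(f has_derivative D) (at x)" and E: "(g has_derivative E) (at x)"
    using assms unfolding differentiable_def by blast
  show ?thesis
    unfolding pd_eqI[OF D] pd_eqI[OF E] pd_eqI[OF has_derivative_add[OF D E]] ..
qed

lemma pd_mult:
  fixes f g :: "real^'d::finite \<Rightarrow> real"
  assumes "f differentiable (at x)" "g differentiable (at x)"
  shows "pd i (\<lambda>y. f y * g y) x = f x * pd i g x + pd i f x * g x"
proof -
  obtain D E where D: "(f has_derivative D) (at x)" and E: "(g has_derivative E) (at x)"
    using assms unfolding differentiable_def by blast
  show ?thesis
    unfolding pd_eqI[OF D] pd_eqI[OF E] pd_eqI[OF has_derivative_mult[OF D E]] ..
qed

lemma pd_divide:
  fixes f g :: "real^'d::finite \<Rightarrow> real"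
  assumes "f differentiable (at x)" "g differentiable (at x)" "g x \<noteq> 0"
  shows "pd i (\<lambda>y. f y / g y) x = (pd i f x * g x - f x * pd i g x) / (g x * g x)"
proof -
  obtain D E where D: "(f has_derivative D) (at x)" and E: "(g has_derivative E) (at x)"
    using assms unfolding differentiable_def by blast
  show ?thesis
    unfolding pd_eqI[OF D] pd_eqI[OF E] pd_eqI[OF has_derivative_divide'[OF D E assms(3)]] ..
qed

lemma pd_powr:
  fixes f :: "real^'d::finite \<Rightarrow> real"
  assumes "f differentiable (at x)" "f x > 0"
  shows "pd i (\<lambda>y. f y powr a) x = a * f x powr (a - 1) * pd i f x"
proof -
  obtain D where D: "(f has_derivative D) (at x)"
    using assms unfolding differentiable_def by blast
  have "((\<lambda>t. t powr a) has_derivative (\<lambda>h. h * (a * f x powr (a - 1)))) (at (f x))"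
    using has_real_derivative_powr[OF assms(2), of a]
    by (simp add: has_field_derivative_def mult_commute_abs)
  from pd_eqI[OF has_derivative_compose[OF D this]] show ?thesis
    by (simp add: pd_eqI[OF D])
qed

lemma pd_bounded_linear:
  assumes "bounded_linear L" "f differentiable (at x)"
  shows "pd i (\<lambda>y. L (f y)) x = L (pd i f x)"
proof -
  obtain D where D: "(f has_derivative D) (at x)"
    using assms unfolding differentiable_def by blast
  show ?thesis
    unfolding pd_eqI[OF D] pd_eqI[OF bounded_linear.has_derivative[OF assms(1) D]] ..
qed

lemma differentiable_bounded_linear:
  "bounded_linear L \<Longrightarrow> f differentiable F \<Longrightarrow> (\<lambda>y. L (f y)) differentiable F"
  unfolding differentiable_def using bounded_linear.has_derivative by blast

lemma differentiable_vec_componentwise: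
  fixes f :: "'a::real_normed_vector \<Rightarrow> real^'d::finite"
  assumes "\<And>i. (\<lambda>y. f y $ i) differentiable (at x)"
  shows "f differentiable (at x)"
proof -
  obtain D where D: "\<And>i. ((\<lambda>y. f y $ i) has_derivative D i) (at x)"
    using assms unfolding differentiable_def by metis
  have "(f has_derivative (\<lambda>h. \<chi> i. D i h)) (at x)"
    by (subst has_derivative_componentwise_within)
       (auto simp: Basis_vec_def inner_axis D)
  then show ?thesis
    unfolding differentiable_def by blast
qed

text \<open>
  Smoothness and formal limits quantify over all iterated derivatives, so they are inherited under
  an operation as soon as that operation commutes with \<open>pds\<close>.  Sums and bounded linear maps do,
  which covers components, scalar multiples and the divergence.  Products and
  quotients need no such closure: they are differentiated once for positive \<open>eps\<close> and at most twice
  in the limit.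
\<close>

lemma pds_append: "pds (is @ js) f = pds is (pds js f)"
  by (induction "is") auto

lemma smooth_differentiable: "smooth f \<Longrightarrow> f differentiable (at x)"
  unfolding smooth_def by (metis pds.simps(1))

lemma smooth_pds: "smooth f \<Longrightarrow> smooth (pds js f)"
  unfolding smooth_def pds_append[symmetric] by blast

lemma smooth_pd: "smooth f \<Longrightarrow> smooth (pd i f)"
  using smooth_pds[of f "[i]"] by simp

lemma pds_add:
  assumes "smooth f" "smooth g"
  shows "pds is (\<lambda>y. f y + g y) = (\<lambda>y. pds is f y + pds is g y)"
proof (induction "is")
  case (Cons i "is")
  show ?case
    unfolding pds.simps Cons
    using assms by (intro ext pd_add) (simp_all add: smooth_def)
qed simp

lemma smooth_add: "smooth f \<Longrightarrow> smooth g \<Longrightarrow> smooth (\<lambda>y. f y + g y)"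
  unfolding smooth_def[of "\<lambda>y. f y + g y"] by (simp add: pds_add) (simp add: smooth_def)

lemma pds_bounded_linear:
  assumes "bounded_linear L" "smooth f"
  shows "pds is (\<lambda>y. L (f y)) = (\<lambda>y. L (pds is f y))"
proof (induction "is")
  case (Cons i "is")
  show ?case
    unfolding pds.simps Cons
    using assms by (intro ext pd_bounded_linear) (simp_all add: smooth_def)
qed simp

lemma smooth_bounded_linear:
  assumes "bounded_linear L" "smooth f"
  shows "smooth (\<lambda>y. L (f y))"
  unfolding smooth_def pds_bounded_linear[OF assms]
  using assms by (auto simp: smooth_def intro: differentiable_bounded_linear)

lemma pds_zero: "pds is (\<lambda>y. 0) = (\<lambda>y. 0)"
proof (induction "is")
  case (Cons i "is")
  show ?case
    unfolding pds.simps Cons by (intro ext pd_eqI[OF has_derivative_const])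
qed simp

lemma smooth_zero: "smooth (\<lambda>y. 0)"
  unfolding smooth_def pds_zero by simp

section \<open>Formal limits\<close>

lemma formal_lim_pds:
  "formal_lim f f0 \<Longrightarrow> ((\<lambda>eps. pds is (f eps) x) \<longlongrightarrow> pds is f0 x) (at_right 0)"
  unfolding formal_lim_def by blast

lemma formal_limD: "formal_lim f f0 \<Longrightarrow> ((\<lambda>eps. f eps x) \<longlongrightarrow> f0 x) (at_right 0)"
  using formal_lim_pds[where ?is = "[]"] by simp

lemma formal_lim_smooth: "formal_lim f f0 \<Longrightarrow> smooth f0"
  unfolding formal_lim_def by blast

lemma formal_lim_differentiable:
  "formal_lim f f0 \<Longrightarrow> \<forall>\<^sub>F eps in at_right 0. \<forall>x. f eps differentiable (at x)"
  unfolding formal_lim_def by (auto elim!: eventually_mono intro: smooth_differentiable)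

lemma formal_lim_cong:
  assumes "formal_lim f f0" "\<forall>\<^sub>F eps in at_right 0. g eps = f eps"
  shows "formal_lim g f0"
  unfolding formal_lim_def
proof (intro conjI allI)
  show "\<forall>\<^sub>F eps in at_right 0. smooth (g eps)"
    using assms unfolding formal_lim_def by (auto elim: eventually_elim2)
  show "smooth f0"
    by (rule formal_lim_smooth[OF assms(1)])
  fix "is" x
  have "\<forall>\<^sub>F eps in at_right 0. pds is (f eps) x = pds is (g eps) x"
    using assms(2) by eventually_elim simp
  then show "((\<lambda>eps. pds is (g eps) x) \<longlongrightarrow> pds is f0 x) (at_right 0)"
    by (rule Lim_transform_eventually[OF formal_lim_pds[OF assms(1)]])
qed

lemma formal_lim_pd:
  assumes "formal_lim f f0"
  shows "formal_lim (\<lambda>eps. pd i (f eps)) (pd i f0)"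
proof -
  have "((\<lambda>eps. pds is (pd i (f eps)) x) \<longlongrightarrow> pds is (pd i f0) x) (at_right 0)" for "is" x
  proof -
    have "((\<lambda>eps. pds (is @ [i]) (f eps) x) \<longlongrightarrow> pds (is @ [i]) f0 x) (at_right 0)"
      by (rule formal_lim_pds[OF assms])
    then show ?thesis
      by (simp add: pds_append)
  qed
  then show ?thesis
    using assms unfolding formal_lim_def by (auto elim!: eventually_mono intro: smooth_pd)
qed

lemma formal_lim_bounded_linear:
  assumes "bounded_linear L" "formal_lim f f0"
  shows "formal_lim (\<lambda>eps y. L (f eps y)) (\<lambda>y. L (f0 y))"
  unfolding formal_lim_def
proof (intro conjI allI)
  have sm: "\<forall>\<^sub>F eps in at_right 0. smooth (f eps)" and sm0: "smooth f0"
    using assms(2) unfolding formal_lim_def by auto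
  show "\<forall>\<^sub>F eps in at_right 0. smooth (\<lambda>y. L (f eps y))"
    using sm by eventually_elim (rule smooth_bounded_linear[OF assms(1)])
  show "smooth (\<lambda>y. L (f0 y))"
    by (rule smooth_bounded_linear[OF assms(1) sm0])
  fix "is" x
  have "((\<lambda>eps. L (pds is (f eps) x)) \<longlongrightarrow> L (pds is f0 x)) (at_right 0)"
    by (intro bounded_linear.tendsto[OF assms(1)] formal_lim_pds assms(2))
  moreover have "\<forall>\<^sub>F eps in at_right 0. L (pds is (f eps) x) = pds is (\<lambda>y. L (f eps y)) x"
    using sm by eventually_elim (simp add: pds_bounded_linear[OF assms(1)])
  ultimately show "((\<lambda>eps. pds is (\<lambda>y. L (f eps y)) x) \<longlongrightarrow> pds is (\<lambda>y. L (f0 y)) x) (at_right 0)"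
    unfolding pds_bounded_linear[OF assms(1) sm0] by (rule Lim_transform_eventually)
qed

lemma formal_lim_add:
  assumes "formal_lim f f0" "formal_lim g g0"
  shows "formal_lim (\<lambda>eps y. f eps y + g eps y) (\<lambda>y. f0 y + g0 y)"
  unfolding formal_lim_def
proof (intro conjI allI)
  have sm: "\<forall>\<^sub>F eps in at_right 0. smooth (f eps) \<and> smooth (g eps)"
    and sm0: "smooth f0" "smooth g0"
    using assms unfolding formal_lim_def by (auto intro: eventually_conj)
  show "\<forall>\<^sub>F eps in at_right 0. smooth (\<lambda>y. f eps y + g eps y)"
    using sm by eventually_elim (simp add: smooth_add)
  show "smooth (\<lambda>y. f0 y + g0 y)"
    by (rule smooth_add[OF sm0])
  fix "is" x
  have "((\<lambda>eps. pds is (f eps) x + pds is (g eps) x) \<longlongrightarrow> pds is f0 x + pds is g0 x) (at_right 0)"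
    by (intro tendsto_add formal_lim_pds assms)
  moreover have "\<forall>\<^sub>F eps in at_right 0.
      pds is (f eps) x + pds is (g eps) x = pds is (\<lambda>y. f eps y + g eps y) x"
    using sm by eventually_elim (simp add: pds_add)
  ultimately show "((\<lambda>eps. pds is (\<lambda>y. f eps y + g eps y) x) \<longlongrightarrow>
      pds is (\<lambda>y. f0 y + g0 y) x) (at_right 0)"
    unfolding pds_add[OF sm0] by (rule Lim_transform_eventually)
qed

lemma formal_lim_zero: "formal_lim (\<lambda>eps y. 0) (\<lambda>y. 0)"
  unfolding formal_lim_def by (simp add: smooth_zero pds_zero)

lemma formal_lim_sum:
  assumes "finite I" "\<And>i. i \<in> I \<Longrightarrow> formal_lim (f i) (f0 i)"
  shows "formal_lim (\<lambda>eps y. \<Sum>i\<in>I. f i eps y) (\<lambda>y. \<Sum>i\<in>I. f0 i y)"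
  using assms by (induction I rule: finite_induct) (auto simp: formal_lim_zero intro!: formal_lim_add)

lemma formal_lim_divergence:
  assumes "formal_lim q q0"
  shows "formal_lim (\<lambda>eps. divergence (q eps)) (divergence q0)"
proof -
  have "formal_lim (\<lambda>eps. pd i (\<lambda>y. q eps y $ i)) (pd i (\<lambda>y. q0 y $ i))" for i
    by (intro formal_lim_pd formal_lim_bounded_linear[OF bounded_linear_vec_nth] assms)
  then show ?thesis
    unfolding divergence_def[abs_def] by (intro formal_lim_sum) auto
qed

text \<open>
  The remainder of the ansatz and all its derivatives are bounded at each point, so the factor
  \<open>eps\<^sup>2\<close> in front of them makes them vanish in the limit.
\<close>

lemma ansatz_formal_lim:
  assumes "ansatz f f0 f2"
  shows "formal_lim f f0"
proof -
  have sm0: "smooth f0" and sm2: "\<forall>\<^sub>F eps in at_right 0. smooth (f2 eps)"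
    and bd: "\<And>is x. Bfun (\<lambda>eps. pds is (f2 eps) x) (at_right 0)"
    and eq: "\<forall>\<^sub>F eps in at_right 0. f eps = (\<lambda>x. f0 x + eps\<^sup>2 *\<^sub>R f2 eps x)"
    using assms unfolding ansatz_def fun_eq_iff by auto
  have sq: "((\<lambda>eps::real. eps\<^sup>2) \<longlongrightarrow> 0) (at_right 0)"
    by (auto intro!: tendsto_eq_intros)
  have "formal_lim (\<lambda>eps y. eps\<^sup>2 *\<^sub>R f2 eps y) (\<lambda>y. 0)"
    unfolding formal_lim_def
  proof (intro conjI allI)
    show "\<forall>\<^sub>F eps in at_right 0. smooth (\<lambda>y. eps\<^sup>2 *\<^sub>R f2 eps y)"
      using sm2 by eventually_elim (rule smooth_bounded_linear[OF bounded_linear_scaleR_right])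
    show "smooth (\<lambda>y::real^_. 0::'b)"
      by (rule smooth_zero)
    fix "is" x
    have "((\<lambda>eps. eps\<^sup>2 *\<^sub>R pds is (f2 eps) x) \<longlongrightarrow> 0) (at_right 0)"
      using bounded_bilinear.Zfun_prod_Bfun[OF bounded_bilinear_scaleR, of "\<lambda>eps. eps\<^sup>2", OF _ bd] sq
      by (simp add: tendsto_Zfun_iff)
    moreover have "\<forall>\<^sub>F eps in at_right 0.
        eps\<^sup>2 *\<^sub>R pds is (f2 eps) x = pds is (\<lambda>y. eps\<^sup>2 *\<^sub>R f2 eps y) x"
      using sm2 by eventually_elim (simp add: pds_bounded_linear[OF bounded_linear_scaleR_right])
    ultimately show "((\<lambda>eps. pds is (\<lambda>y. eps\<^sup>2 *\<^sub>R f2 eps y) x) \<longlongrightarrow> pds is (\<lambda>y. 0) x) (at_right 0)"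
      unfolding pds_zero by (rule Lim_transform_eventually)
  qed
  moreover have "formal_lim (\<lambda>eps. f0) f0"
    unfolding formal_lim_def using sm0 by simp
  ultimately have "formal_lim (\<lambda>eps y. f0 y + eps\<^sup>2 *\<^sub>R f2 eps y) (\<lambda>y. f0 y + 0)"
    by (intro formal_lim_add)
  then show ?thesis
    using formal_lim_cong[OF _ eq] by simp
qed

section \<open>The quasineutral limit of the momentum flux\<close>

text \<open>
  Convergence to the constant density \<open>1\<close> makes the density positive at \<open>x\<close> once \<open>eps\<close> is small,
  hence in a neighbourhood of \<open>x\<close> that may depend on \<open>eps\<close>.  This suffices because the flux at \<open>x\<close>
  depends only on the germs of its arguments there.  In the limit the derivatives of the density vanish, which kills
  the pressure gradient and the part of the convection term that differentiates \<open>1 / rho\<close>.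
\<close>

lemma tendsto_momentum_flux:
  fixes rho phi :: "real \<Rightarrow> real^'d::finite \<Rightarrow> real" and q :: "real \<Rightarrow> real^'d \<Rightarrow> real^'d"
  assumes rho: "formal_lim rho (\<lambda>x. 1)" and q: "formal_lim q q0" and phi: "formal_lim phi phi0"
  shows "((\<lambda>eps. momentum_flux gam (rho eps) (q eps) (phi eps) x) \<longlongrightarrow>
           incompressible_flux q0 phi0 x) (at_right 0)"
proof -
  have qi: "formal_lim (\<lambda>eps y. q eps y $ i) (\<lambda>y. q0 y $ i)" for i
    by (intro formal_lim_bounded_linear[OF bounded_linear_vec_nth] q)
  have q_lim: "((\<lambda>eps. q eps x $ i) \<longlongrightarrow> q0 x $ i) (at_right 0)" for i
    using formal_limD[OF qi] .
  have dq_lim: "((\<lambda>eps. pd j (\<lambda>y. q eps y $ i) x) \<longlongrightarrow> pd j (\<lambda>y. q0 y $ i) x) (at_right 0)" for i j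
    using formal_limD[OF formal_lim_pd[OF qi]] .
  have dphi_lim: "((\<lambda>eps. pd i (phi eps) x) \<longlongrightarrow> pd i phi0 x) (at_right 0)" for i
    using formal_limD[OF formal_lim_pd[OF phi]] .
  have rho_lim: "((\<lambda>eps. rho eps x) \<longlongrightarrow> 1) (at_right 0)"
    using formal_limD[OF rho] .
  have drho_lim: "((\<lambda>eps. pd i (rho eps) x) \<longlongrightarrow> 0) (at_right 0)" for i
    using formal_limD[OF formal_lim_pd[OF rho], of i x] by (simp add: pd_eqI[OF has_derivative_const])
  have pos: "\<forall>\<^sub>F eps in at_right 0. 0 < rho eps x"
    by (rule order_tendstoD(1)[OF rho_lim]) simp
  have rho_diff: "\<forall>\<^sub>F eps in at_right 0. rho eps differentiable (at x)"
    using formal_lim_differentiable[OF rho] by (rule eventually_mono) blast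
  have q_diff: "\<forall>\<^sub>F eps in at_right 0. (\<lambda>y. q eps y $ i) differentiable (at x)" for i
    using formal_lim_differentiable[OF qi[of i]] by (rule eventually_mono) blast
  have q0_diff: "(\<lambda>y. q0 y $ i) differentiable (at x)" for i
    by (rule smooth_differentiable[OF formal_lim_smooth[OF qi]])

  have convection: "((\<lambda>eps. pd j (\<lambda>y. q eps y $ i * q eps y $ j / rho eps y) x) \<longlongrightarrow>
      pd j (\<lambda>y. q0 y $ i * q0 y $ j) x) (at_right 0)" for i j
  proof (rule Lim_transform_eventually)
    show "\<forall>\<^sub>F eps in at_right 0.
        ((q eps x $ i * pd j (\<lambda>y. q eps y $ j) x + pd j (\<lambda>y. q eps y $ i) x * q eps x $ j) * rho eps x
          - (q eps x $ i * q eps x $ j) * pd j (rho eps) x) / (rho eps x * rho eps x)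
        = pd j (\<lambda>y. q eps y $ i * q eps y $ j / rho eps y) x"
      using pos rho_diff q_diff[of i] q_diff[of j]
      by eventually_elim (simp add: pd_divide pd_mult differentiable_mult)
    show "((\<lambda>eps.
        ((q eps x $ i * pd j (\<lambda>y. q eps y $ j) x + pd j (\<lambda>y. q eps y $ i) x * q eps x $ j) * rho eps x
          - (q eps x $ i * q eps x $ j) * pd j (rho eps) x) / (rho eps x * rho eps x)) \<longlongrightarrow>
        pd j (\<lambda>y. q0 y $ i * q0 y $ j) x) (at_right 0)"
      unfolding pd_mult[OF q0_diff q0_diff]
      by (rule tendsto_eq_rhs, (rule tendsto_intros q_lim dq_lim rho_lim drho_lim)+) simp_all
  qed

  have pressure: "((\<lambda>eps. pd i (\<lambda>y. rho eps y powr gam) x) \<longlongrightarrow> 0) (at_right 0)" for i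
  proof (rule Lim_transform_eventually)
    show "\<forall>\<^sub>F eps in at_right 0. gam * rho eps x powr (gam - 1) * pd i (rho eps) x
        = pd i (\<lambda>y. rho eps y powr gam) x"
      using pos rho_diff by eventually_elim (simp add: pd_powr)
    have "((\<lambda>eps. gam * rho eps x powr (gam - 1) * pd i (rho eps) x) \<longlongrightarrow>
        gam * 1 powr (gam - 1) * 0) (at_right 0)"
      by (intro tendsto_intros rho_lim drho_lim) simp
    then show "((\<lambda>eps. gam * rho eps x powr (gam - 1) * pd i (rho eps) x) \<longlongrightarrow> 0) (at_right 0)"
      by simp
  qed

  have "((\<lambda>eps. (\<Sum>j\<in>UNIV. pd j (\<lambda>y. q eps y $ i * q eps y $ j / rho eps y) x)
          + pd i (\<lambda>y. rho eps y powr gam) x - rho eps x * pd i (phi eps) x) \<longlongrightarrow>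
        (\<Sum>j\<in>UNIV. pd j (\<lambda>y. q0 y $ i * q0 y $ j) x) + 0 - 1 * pd i phi0 x) (at_right 0)" for i
    by (intro tendsto_intros convection pressure rho_lim dphi_lim)
  then show ?thesis
    by (intro vec_tendstoI)
       (simp add: momentum_flux_def incompressible_flux_def tensor_divergence_def gradient_def
          outer_def divide_inverse mult.commute mult.left_commute)
qed

section \<open>Divergence of the limit momentum equations\<close>

lemma divergence_eqI:
  assumes "(q has_derivative D) (at x)"
  shows "divergence q x = (\<Sum>i\<in>UNIV. D (axis i 1) $ i)"
  unfolding divergence_def
  by (intro sum.cong refl pd_eqI bounded_linear.has_derivative[OF bounded_linear_vec_nth assms])

lemma divergence_diff_scaleR_sum:
  assumes "q differentiable (at x)" "\<And>l. l \<in> I \<Longrightarrow> F l differentiable (at x)"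
  shows "divergence (\<lambda>y. q y - c *\<^sub>R (\<Sum>l\<in>I. a l *\<^sub>R F l y)) x
    = divergence q x - c * (\<Sum>l\<in>I. a l * divergence (F l) x)"
proof -
  obtain D where D: "(q has_derivative D) (at x)"
    using assms(1) unfolding differentiable_def by blast
  obtain E where E: "\<And>l. l \<in> I \<Longrightarrow> (F l has_derivative E l) (at x)"
    using assms(2) unfolding differentiable_def by metis
  have "((\<lambda>y. q y - c *\<^sub>R (\<Sum>l\<in>I. a l *\<^sub>R F l y)) has_derivative
      (\<lambda>h. D h - c *\<^sub>R (\<Sum>l\<in>I. a l *\<^sub>R E l h))) (at x)"
    by (intro has_derivative_diff has_derivative_scaleR_right has_derivative_sum D E)
  from divergence_eqI[OF this] have "divergence (\<lambda>y. q y - c *\<^sub>R (\<Sum>l\<in>I. a l *\<^sub>R F l y)) x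
      = (\<Sum>i\<in>UNIV. D (axis i 1) $ i) - c * (\<Sum>i\<in>UNIV. \<Sum>l\<in>I. a l * E l (axis i 1) $ i)"
    by (simp add: sum_subtractf sum_distrib_left)
  also have "(\<Sum>i\<in>UNIV. \<Sum>l\<in>I. a l * E l (axis i 1) $ i) = (\<Sum>l\<in>I. a l * divergence (F l) x)"
    by (subst sum.swap, intro sum.cong refl) (simp only: divergence_eqI[OF E] sum_distrib_left)
  finally show ?thesis
    unfolding divergence_eqI[OF D] .
qed

lemma pd_outer_differentiable:
  assumes "smooth u"
  shows "pd j (\<lambda>y. outer (u y) (u y) $ i $ j) differentiable (at x)"
proof -
  have sm: "smooth (\<lambda>y. u y $ i)" for i
    by (rule smooth_bounded_linear[OF bounded_linear_vec_nth assms])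
  have "pd j (\<lambda>y. outer (u y) (u y) $ i $ j) =
      (\<lambda>x. u x $ i * pd j (\<lambda>y. u y $ j) x + pd j (\<lambda>y. u y $ i) x * u x $ j)"
    by (simp add: fun_eq_iff outer_def pd_mult smooth_differentiable[OF sm])
  then show ?thesis
    by (auto intro!: differentiable_add differentiable_mult
        smooth_differentiable[OF sm] smooth_differentiable[OF smooth_pd[OF sm]])
qed

lemma incompressible_flux_nth:
  "incompressible_flux u phi x $ i
     = (\<Sum>j\<in>UNIV. pd j (\<lambda>y. outer (u y) (u y) $ i $ j) x) - pd i phi x"
  by (simp add: incompressible_flux_def tensor_divergence_def gradient_def)

lemma incompressible_flux_differentiable:
  assumes "smooth u" "smooth phi"
  shows "incompressible_flux u phi differentiable (at x)"
  by (intro differentiable_vec_componentwise, unfold incompressible_flux_nth)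
     (intro differentiable_diff differentiable_sum ballI finite pd_outer_differentiable
        smooth_differentiable[OF smooth_pd] assms)

text \<open>
  The flux divergence is the residual of the elliptic equation for the potential, which is why
  divergence-free stages force that equation.
\<close>

lemma divergence_incompressible_flux:
  assumes "smooth u" "smooth phi"
  shows "divergence (incompressible_flux u phi) x
    = hess_contract (\<lambda>y. outer (u y) (u y)) x - laplacian phi x"
proof -
  have pd_nth: "pd i (\<lambda>y. incompressible_flux u phi y $ i) x
      = (\<Sum>j\<in>UNIV. pd i (pd j (\<lambda>y. outer (u y) (u y) $ i $ j)) x) - pd i (pd i phi) x" for i
  proof -
    define D where "D j = frechet_derivative (pd j (\<lambda>y. outer (u y) (u y) $ i $ j)) (at x)" for j
    define E where "E = frechet_derivative (pd i phi) (at x)"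
    have D: "(pd j (\<lambda>y. outer (u y) (u y) $ i $ j) has_derivative D j) (at x)" for j
      unfolding D_def frechet_derivative_works[symmetric] by (rule pd_outer_differentiable[OF assms(1)])
    have E: "(pd i phi has_derivative E) (at x)"
      unfolding E_def frechet_derivative_works[symmetric]
      by (rule smooth_differentiable[OF smooth_pd[OF assms(2)]])
    have "((\<lambda>y. incompressible_flux u phi y $ i) has_derivative
        (\<lambda>h. (\<Sum>j\<in>UNIV. D j h) - E h)) (at x)"
      unfolding incompressible_flux_nth by (intro has_derivative_diff has_derivative_sum D E)
    from pd_eqI[OF this] show ?thesis
      unfolding pd_eqI[OF D] pd_eqI[OF E] .
  qed
  show ?thesis
    by (simp add: divergence_def pd_nth hess_contract_def laplacian_def sum_subtractf)
qed

text \<open>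
  Forward substitution.  It is used twice, for the divergences of the implicit momenta and for the
  flux divergences.
\<close>

lemma triangular_system_zero:
  fixes A :: "nat \<Rightarrow> nat \<Rightarrow> 'a::idom"
  assumes diag: "\<forall>k\<in>{1..s}. A k k \<noteq> 0"
    and system: "\<And>k. k \<in> {1..s} \<Longrightarrow> (\<Sum>l\<in>{1..k}. A k l * c l) = 0"
    and "k \<in> {1..s}"
  shows "c k = 0"
  using \<open>k \<in> {1..s}\<close>
proof (induction k rule: less_induct)
  case (less k)
  have "{1..k} = insert k {1..<k}"
    using less.prems by auto
  then have "(\<Sum>l\<in>{1..k}. A k l * c l) = A k k * c k + (\<Sum>l\<in>{1..<k}. A k l * c l)"
    by simp
  also have "(\<Sum>l\<in>{1..<k}. A k l * c l) = 0"
    using less by (intro sum.neutral) auto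
  finally show ?case
    using system[OF less.prems] diag less.prems by auto
qed

section \<open>Asymptotic consistency\<close>

theorem theorem5p1:
  fixes s :: nat and At A :: "nat \<Rightarrow> nat \<Rightarrow> real" and w :: "nat \<Rightarrow> real"
    and dt gam :: real
    and rhon rhon2 :: "real \<Rightarrow> real^'d::finite \<Rightarrow> real" and rhon0 :: "real^'d \<Rightarrow> real"
    and qn qn2 :: "real \<Rightarrow> real^'d \<Rightarrow> real^'d" and qn0 :: "real^'d \<Rightarrow> real^'d"
    and rhoE rhoI phiI rhoE2 rhoI2 :: "real \<Rightarrow> nat \<Rightarrow> real^'d \<Rightarrow> real"
    and qE qI qE2 qI2 :: "real \<Rightarrow> nat \<Rightarrow> real^'d \<Rightarrow> real^'d"
    and rhoE0 rhoI0 phiI0 :: "nat \<Rightarrow> real^'d \<Rightarrow> real"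
    and qE0 qI0 :: "nat \<Rightarrow> real^'d \<Rightarrow> real^'d"
    and rho1 phi1 :: "real \<Rightarrow> real^'d \<Rightarrow> real" and q1 :: "real \<Rightarrow> real^'d \<Rightarrow> real^'d"
  assumes "1 \<le> s" and "strictly_lower s At" and "dirk s A"
    and diag_nonzero: "\<forall>k\<in>{1..s}. A k k \<noteq> 0"
    and "stiffly_accurate s A w"
    and "0 < dt" and "1 < gam"
    and data: "well_prepared rhon qn rhon0 qn0 rhon2 qn2"
    and stages: "\<forall>\<^sub>F eps in at_right 0.
      si_imex_rk_dae_stages s At A dt gam eps (rhon eps) (qn eps)
        (rhoE eps) (qE eps) (rhoI eps) (qI eps) (phiI eps)"
    and update: "\<forall>\<^sub>F eps in at_right 0.
      rho1 eps = rhoI eps s \<and> q1 eps = qI eps s \<and> phi1 eps = phiI eps s"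
    and expansions: "\<forall>k\<in>{1..s}.
      ansatz (\<lambda>eps. rhoE eps k) (rhoE0 k) (\<lambda>eps. rhoE2 eps k) \<and>
      ansatz (\<lambda>eps. qE eps k) (qE0 k) (\<lambda>eps. qE2 eps k) \<and>
      ansatz (\<lambda>eps. rhoI eps k) (rhoI0 k) (\<lambda>eps. rhoI2 eps k) \<and>
      ansatz (\<lambda>eps. qI eps k) (qI0 k) (\<lambda>eps. qI2 eps k) \<and>
      formal_lim (\<lambda>eps. phiI eps k) (phiI0 k)"
  shows
    "(\<forall>k\<in>{1..s}.
        formal_lim (\<lambda>eps. rhoE eps k) (rhoE0 k) \<and> rhoE0 k = (\<lambda>x. 1) \<and>
        formal_lim (\<lambda>eps. rhoI eps k) (rhoI0 k) \<and> rhoI0 k = (\<lambda>x. 1) \<and>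
        formal_lim (\<lambda>eps. divergence (qE eps k)) (divergence (qE0 k)) \<and>
        divergence (qE0 k) = (\<lambda>x. 0) \<and>
        formal_lim (\<lambda>eps. divergence (qI eps k)) (divergence (qI0 k)) \<and>
        divergence (qI0 k) = (\<lambda>x. 0) \<and>
        well_prepared (\<lambda>eps. rhoE eps k) (\<lambda>eps. qE eps k) (rhoE0 k) (qE0 k)
          (\<lambda>eps. rhoE2 eps k) (\<lambda>eps. qE2 eps k) \<and>
        well_prepared (\<lambda>eps. rhoI eps k) (\<lambda>eps. qI eps k) (rhoI0 k) (qI0 k)
          (\<lambda>eps. rhoI2 eps k) (\<lambda>eps. qI2 eps k)) \<and>
     (\<exists>rho10 q10 phi10.
        formal_lim rho1 rho10 \<and> formal_lim q1 q10 \<and> formal_lim phi1 phi10 \<and>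
        incompressible_rk_scheme s At A dt (velocity rhon0 qn0)
          rhoE0 (\<lambda>k. velocity (rhoE0 k) (qE0 k))
          rhoI0 (\<lambda>k. velocity (rhoI0 k) (qI0 k)) phiI0
          rho10 (velocity rho10 q10) phi10)"
proof -
  have rhoE: "formal_lim (\<lambda>eps. rhoE eps k) (rhoE0 k)"
    and qE: "formal_lim (\<lambda>eps. qE eps k) (qE0 k)"
    and rhoI: "formal_lim (\<lambda>eps. rhoI eps k) (rhoI0 k)"
    and qI: "formal_lim (\<lambda>eps. qI eps k) (qI0 k)"
    and phiI: "formal_lim (\<lambda>eps. phiI eps k) (phiI0 k)" if "k \<in> {1..s}" for k
    using expansions that by (auto intro: ansatz_formal_lim)
  have rhon: "formal_lim rhon rhon0" and qn: "formal_lim qn qn0"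
    and rhon0: "\<And>x. rhon0 x = 1" and div_qn0: "\<And>x. divergence qn0 x = 0"
    using data unfolding well_prepared_def by (auto intro: ansatz_formal_lim)
  have sub: "l \<in> {1..s}" if "k \<in> {1..s}" "l \<in> {1..k}" for k l
    using that by auto
  have sub': "l \<in> {1..s}" if "k \<in> {1..s}" "l \<in> {1..<k}" for k l
    using that by auto
  note stage_eqs = stages[unfolded si_imex_rk_dae_stages_def]

  \<comment> \<open>The Laplacians of the potentials converge, so the factor \<open>eps\<^sup>2\<close> in the Poisson equation
     forces quasineutrality of the implicit stages.\<close>
  have rhoI0: "rhoI0 k = (\<lambda>x. 1)" if k: "k \<in> {1..s}" for k
  proof
    fix x
    have "formal_lim (\<lambda>eps y. \<Sum>i\<in>UNIV. pd i (pd i (phiI eps k)) y)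
        (\<lambda>y. \<Sum>i\<in>UNIV. pd i (pd i (phiI0 k)) y)"
      by (intro formal_lim_sum formal_lim_pd phiI k) auto
    from formal_limD[OF this]
    have lap: "((\<lambda>eps. laplacian (phiI eps k) x) \<longlongrightarrow> laplacian (phiI0 k) x) (at_right 0)"
      unfolding laplacian_def .
    have "((\<lambda>eps. 1 + eps\<^sup>2 * laplacian (phiI eps k) x) \<longlongrightarrow> 1 + 0\<^sup>2 * laplacian (phiI0 k) x) (at_right 0)"
      by (intro tendsto_intros lap)
    moreover have "\<forall>\<^sub>F eps in at_right 0. 1 + eps\<^sup>2 * laplacian (phiI eps k) x = rhoI eps k x"
      using stage_eqs by eventually_elim (use k in auto)
    ultimately have "((\<lambda>eps. rhoI eps k x) \<longlongrightarrow> 1) (at_right 0)"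
      by (simp add: Lim_transform_eventually)
    then show "rhoI0 k x = 1"
      using tendsto_unique[OF _ formal_limD[OF rhoI[OF k]]] by simp
  qed

  have div_lim: "((\<lambda>eps. divergence (qI eps l) x) \<longlongrightarrow> divergence (qI0 l) x) (at_right 0)"
    if "l \<in> {1..s}" for l x
    by (rule formal_limD[OF formal_lim_divergence[OF qI[OF that]]])

  have div_qI0: "divergence (qI0 k) x = 0" if "k \<in> {1..s}" for k x
  proof (rule triangular_system_zero[where A = A and c = "\<lambda>l. divergence (qI0 l) x", OF diag_nonzero _ that])
    fix k assume k: "k \<in> {1..s}"
    have "((\<lambda>eps. rhon eps x - dt * (\<Sum>l\<in>{1..k}. A k l * divergence (qI eps l) x)) \<longlongrightarrow>
        rhon0 x - dt * (\<Sum>l\<in>{1..k}. A k l * divergence (qI0 l) x)) (at_right 0)"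
      by (intro tendsto_intros formal_limD[OF rhon] div_lim sub[OF k])
    moreover have "\<forall>\<^sub>F eps in at_right 0.
        rhon eps x - dt * (\<Sum>l\<in>{1..k}. A k l * divergence (qI eps l) x) = rhoI eps k x"
      using stage_eqs by eventually_elim (use k in auto)
    ultimately have "((\<lambda>eps. rhoI eps k x) \<longlongrightarrow>
        rhon0 x - dt * (\<Sum>l\<in>{1..k}. A k l * divergence (qI0 l) x)) (at_right 0)"
      by (rule Lim_transform_eventually)
    then have "rhoI0 k x = rhon0 x - dt * (\<Sum>l\<in>{1..k}. A k l * divergence (qI0 l) x)"
      using tendsto_unique[OF _ formal_limD[OF rhoI[OF k]]] by simp
    then show "(\<Sum>l\<in>{1..k}. A k l * divergence (qI0 l) x) = 0"
      using \<open>0 < dt\<close> by (simp add: rhoI0[OF k] rhon0)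
  qed

  have rhoE0: "rhoE0 k = (\<lambda>x. 1)" if k: "k \<in> {1..s}" for k
  proof
    fix x
    have "((\<lambda>eps. rhon eps x - dt * (\<Sum>l\<in>{1..<k}. At k l * divergence (qI eps l) x)) \<longlongrightarrow>
        rhon0 x - dt * (\<Sum>l\<in>{1..<k}. At k l * divergence (qI0 l) x)) (at_right 0)"
      by (intro tendsto_intros formal_limD[OF rhon] div_lim sub'[OF k])
    moreover have "\<forall>\<^sub>F eps in at_right 0.
        rhon eps x - dt * (\<Sum>l\<in>{1..<k}. At k l * divergence (qI eps l) x) = rhoE eps k x"
      using stage_eqs by eventually_elim (use k in auto)
    ultimately have "((\<lambda>eps. rhoE eps k x) \<longlongrightarrow>
        rhon0 x - dt * (\<Sum>l\<in>{1..<k}. At k l * divergence (qI0 l) x)) (at_right 0)"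
      by (rule Lim_transform_eventually)
    moreover have "(\<Sum>l\<in>{1..<k}. At k l * divergence (qI0 l) x) = 0"
      using k by (intro sum.neutral) (auto simp: div_qI0)
    ultimately show "rhoE0 k x = 1"
      using tendsto_unique[OF _ formal_limD[OF rhoE[OF k]]] by (simp add: rhon0)
  qed

  define F where "F l = incompressible_flux (qE0 l) (phiI0 l)" for l
  have flux_lim: "((\<lambda>eps. momentum_flux gam (rhoE eps l) (qE eps l) (phiI eps l) x) \<longlongrightarrow> F l x)
      (at_right 0)" if l: "l \<in> {1..s}" for l x
    unfolding F_def
    by (rule tendsto_momentum_flux[OF rhoE[OF l, unfolded rhoE0[OF l]] qE[OF l] phiI[OF l]])

  have qE0: "qE0 k x = qn0 x - dt *\<^sub>R (\<Sum>l\<in>{1..<k}. At k l *\<^sub>R F l x)"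
    if k: "k \<in> {1..s}" for k x
  proof -
    have "((\<lambda>eps. qn eps x - dt *\<^sub>R (\<Sum>l\<in>{1..<k}. At k l *\<^sub>R
          momentum_flux gam (rhoE eps l) (qE eps l) (phiI eps l) x)) \<longlongrightarrow>
        qn0 x - dt *\<^sub>R (\<Sum>l\<in>{1..<k}. At k l *\<^sub>R F l x)) (at_right 0)"
      by (intro tendsto_intros formal_limD[OF qn] flux_lim sub'[OF k])
    moreover have "\<forall>\<^sub>F eps in at_right 0. qn eps x - dt *\<^sub>R (\<Sum>l\<in>{1..<k}. At k l *\<^sub>R
          momentum_flux gam (rhoE eps l) (qE eps l) (phiI eps l) x) = qE eps k x"
      using stage_eqs by eventually_elim (use k in auto)
    ultimately have "((\<lambda>eps. qE eps k x) \<longlongrightarrow>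
        qn0 x - dt *\<^sub>R (\<Sum>l\<in>{1..<k}. At k l *\<^sub>R F l x)) (at_right 0)"
      by (rule Lim_transform_eventually)
    then show ?thesis
      using tendsto_unique[OF _ formal_limD[OF qE[OF k]]] by simp
  qed

  have qI0: "qI0 k x = qn0 x - dt *\<^sub>R (\<Sum>l\<in>{1..k}. A k l *\<^sub>R F l x)"
    if k: "k \<in> {1..s}" for k x
  proof -
    have "((\<lambda>eps. qn eps x - dt *\<^sub>R (\<Sum>l\<in>{1..k}. A k l *\<^sub>R
          momentum_flux gam (rhoE eps l) (qE eps l) (phiI eps l) x)) \<longlongrightarrow>
        qn0 x - dt *\<^sub>R (\<Sum>l\<in>{1..k}. A k l *\<^sub>R F l x)) (at_right 0)"
      by (intro tendsto_intros formal_limD[OF qn] flux_lim sub[OF k])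
    moreover have "\<forall>\<^sub>F eps in at_right 0. qn eps x - dt *\<^sub>R (\<Sum>l\<in>{1..k}. A k l *\<^sub>R
          momentum_flux gam (rhoE eps l) (qE eps l) (phiI eps l) x) = qI eps k x"
      using stage_eqs by eventually_elim (use k in auto)
    ultimately have "((\<lambda>eps. qI eps k x) \<longlongrightarrow>
        qn0 x - dt *\<^sub>R (\<Sum>l\<in>{1..k}. A k l *\<^sub>R F l x)) (at_right 0)"
      by (rule Lim_transform_eventually)
    then show ?thesis
      using tendsto_unique[OF _ formal_limD[OF qI[OF k]]] by simp
  qed

  have qn0_diff: "qn0 differentiable (at x)" for x
    by (rule smooth_differentiable[OF formal_lim_smooth[OF qn]])
  have F_diff: "F l differentiable (at x)" if "l \<in> {1..s}" for l x
    unfolding F_def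
    by (intro incompressible_flux_differentiable formal_lim_smooth[OF qE] formal_lim_smooth[OF phiI] that)

  \<comment> \<open>Both the old and the implicit momenta are divergence-free, so only the triangular combination
     of the flux divergences is left in the divergence of the implicit momentum equation.\<close>
  have div_F: "divergence (F k) x = 0" if "k \<in> {1..s}" for k x
  proof (rule triangular_system_zero[where A = A and c = "\<lambda>l. divergence (F l) x", OF diag_nonzero _ that])
    fix k assume k: "k \<in> {1..s}"
    have "qI0 k = (\<lambda>x. qn0 x - dt *\<^sub>R (\<Sum>l\<in>{1..k}. A k l *\<^sub>R F l x))"
      using qI0[OF k] by auto
    then have "divergence (qI0 k) x
        = divergence qn0 x - dt * (\<Sum>l\<in>{1..k}. A k l * divergence (F l) x)"
      by (simp only:) (intro divergence_diff_scaleR_sum qn0_diff F_diff sub[OF k])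
    then show "(\<Sum>l\<in>{1..k}. A k l * divergence (F l) x) = 0"
      using \<open>0 < dt\<close> by (simp add: div_qI0[OF k] div_qn0)
  qed

  have div_qE0: "divergence (qE0 k) x = 0" if k: "k \<in> {1..s}" for k x
  proof -
    have "qE0 k = (\<lambda>x. qn0 x - dt *\<^sub>R (\<Sum>l\<in>{1..<k}. At k l *\<^sub>R F l x))"
      using qE0[OF k] by auto
    then have "divergence (qE0 k) x
        = divergence qn0 x - dt * (\<Sum>l\<in>{1..<k}. At k l * divergence (F l) x)"
      by (simp only:) (intro divergence_diff_scaleR_sum qn0_diff F_diff sub'[OF k])
    also have "(\<Sum>l\<in>{1..<k}. At k l * divergence (F l) x) = 0"
      using k by (intro sum.neutral) (auto simp: div_F)
    finally show ?thesis
      by (simp add: div_qn0)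
  qed

  have elliptic: "laplacian (phiI0 k) x = hess_contract (\<lambda>y. outer (qE0 k y) (qE0 k y)) x"
    if k: "k \<in> {1..s}" for k x
    using div_F[OF k, of x]
      divergence_incompressible_flux[OF formal_lim_smooth[OF qE[OF k]] formal_lim_smooth[OF phiI[OF k]]]
    by (simp add: F_def)

  have stage_limits: "formal_lim (\<lambda>eps. rhoE eps k) (rhoE0 k) \<and> rhoE0 k = (\<lambda>x. 1) \<and>
        formal_lim (\<lambda>eps. rhoI eps k) (rhoI0 k) \<and> rhoI0 k = (\<lambda>x. 1) \<and>
        formal_lim (\<lambda>eps. divergence (qE eps k)) (divergence (qE0 k)) \<and>
        divergence (qE0 k) = (\<lambda>x. 0) \<and>
        formal_lim (\<lambda>eps. divergence (qI eps k)) (divergence (qI0 k)) \<and>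
        divergence (qI0 k) = (\<lambda>x. 0) \<and>
        well_prepared (\<lambda>eps. rhoE eps k) (\<lambda>eps. qE eps k) (rhoE0 k) (qE0 k)
          (\<lambda>eps. rhoE2 eps k) (\<lambda>eps. qE2 eps k) \<and>
        well_prepared (\<lambda>eps. rhoI eps k) (\<lambda>eps. qI eps k) (rhoI0 k) (qI0 k)
          (\<lambda>eps. rhoI2 eps k) (\<lambda>eps. qI2 eps k)" if k: "k \<in> {1..s}" for k
  proof (intro conjI)
    show "well_prepared (\<lambda>eps. rhoE eps k) (\<lambda>eps. qE eps k) (rhoE0 k) (qE0 k)
        (\<lambda>eps. rhoE2 eps k) (\<lambda>eps. qE2 eps k)"
      unfolding well_prepared_def
      using bspec[OF expansions k] by (simp add: rhoE0[OF k] div_qE0[OF k])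
    show "well_prepared (\<lambda>eps. rhoI eps k) (\<lambda>eps. qI eps k) (rhoI0 k) (qI0 k)
        (\<lambda>eps. rhoI2 eps k) (\<lambda>eps. qI2 eps k)"
      unfolding well_prepared_def
      using bspec[OF expansions k] by (simp add: rhoI0[OF k] div_qI0[OF k])
  qed (intro rhoE rhoI rhoE0 rhoI0 formal_lim_divergence qE qI ext div_qE0 div_qI0 k)+

  have velocity_one: "velocity (\<lambda>x. 1) q = q" for q :: "real^'d \<Rightarrow> real^'d"
    by (simp add: velocity_def fun_eq_iff)
  have velocity_n: "velocity rhon0 qn0 = qn0"
    using rhon0 by (simp add: velocity_def fun_eq_iff)

  have s: "s \<in> {1..s}"
    using \<open>1 \<le> s\<close> by simp
  have "incompressible_rk_scheme s At A dt (velocity rhon0 qn0)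
      rhoE0 (\<lambda>k. velocity (rhoE0 k) (qE0 k))
      rhoI0 (\<lambda>k. velocity (rhoI0 k) (qI0 k)) phiI0
      (rhoI0 s) (velocity (rhoI0 s) (qI0 s)) (phiI0 s)"
    unfolding incompressible_rk_scheme_def
  proof (intro conjI ballI allI refl)
    fix k x assume k: "k \<in> {1..s}"
    show "rhoE0 k x = 1" "rhoI0 k x = 1"
      by (simp_all add: rhoE0[OF k] rhoI0[OF k])
    show "velocity (rhoE0 k) (qE0 k) x = velocity rhon0 qn0 x - dt *\<^sub>R (\<Sum>l\<in>{1..<k}.
        At k l *\<^sub>R incompressible_flux (velocity (rhoE0 l) (qE0 l)) (phiI0 l) x)"
      using k by (simp add: qE0 rhoE0 velocity_one velocity_n F_def)
    show "velocity (rhoI0 k) (qI0 k) x = velocity rhon0 qn0 x - dt *\<^sub>R (\<Sum>l\<in>{1..k}.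
        A k l *\<^sub>R incompressible_flux (velocity (rhoE0 l) (qE0 l)) (phiI0 l) x)"
      using k by (simp add: qI0 rhoE0 rhoI0 velocity_one velocity_n F_def)
    show "laplacian (phiI0 k) x = hess_contract
        (\<lambda>y. outer (velocity (rhoE0 k) (qE0 k) y) (velocity (rhoE0 k) (qE0 k) y)) x"
      using k by (simp add: elliptic rhoE0 velocity_one)
  qed
  moreover have "formal_lim rho1 (rhoI0 s)" "formal_lim q1 (qI0 s)" "formal_lim phi1 (phiI0 s)"
    by (rule formal_lim_cong[OF rhoI[OF s]] formal_lim_cong[OF qI[OF s]]
        formal_lim_cong[OF phiI[OF s]], use update in eventually_elim, simp)+
  ultimately show ?thesis
    by (intro conjI ballI stage_limits exI)
qed

end
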